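(* Let $G$ be a finite, simple, connected graph with order $n(G)$ and clique number $\omega(G)$. If $n(G) \geq \omega(G) + 1 \geq 4$, then $$\dim_{A,l}(G) \leq \left\lfloor \left(\frac{\omega(G) - 2}{\omega(G) - 1}\right) n(G)\right\rfloor .$$
   Context: For a finite, simple, connected graph $G$ with vertex set $V(G)$, $n(G)=|V(G)|$ denotes its order and $\omega(G)$ its clique number (the largest number of pairwise adjacent vertices). For $S \subseteq V(G)$ let $\overline{S} = V(G)\setminus S$. The set $S$ is a local adjacency resolving set of $G$ if for any two adjacent vertices from $\overline{S}$ there exists a vertex of $S$ that is adjacent to exactly one of them. The local adjacency metric dimension $\dim_{A,l}(G)$ is the cardinality of a smallest local adjacency resolving set of $G$. *)

theory Defs
  imports Complex_Main "Graph_Theory.Digraph_Component"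
begin

text \<open>
  A finite simple graph is a symmetric digraph without loops and parallel arcs
  (the locale predicate \<^const>\<open>graph\<close>), so an edge is a pair of opposite arcs and
  \<open>u \<rightarrow>\<^bsub>G\<^esub> v\<close> expresses adjacency of \<open>u\<close> and \<open>v\<close>.
\<close>

definition clique :: "('a, 'b) pre_digraph \<Rightarrow> 'a set \<Rightarrow> bool" where
  "clique G K \<longleftrightarrow> K \<subseteq> verts G \<and> (\<forall>u\<in>K. \<forall>v\<in>K. u \<noteq> v \<longrightarrow> u \<rightarrow>\<^bsub>G\<^esub> v)"

definition clique_number :: "('a, 'b) pre_digraph \<Rightarrow> nat" where
  "clique_number G = Max (card ` {K. clique G K})"

definition local_adjacency_resolving :: "('a, 'b) pre_digraph \<Rightarrow> 'a set \<Rightarrow> bool" where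
  "local_adjacency_resolving G S \<longleftrightarrow>
     S \<subseteq> verts G \<and>
     (\<forall>u \<in> verts G - S. \<forall>v \<in> verts G - S.
        u \<rightarrow>\<^bsub>G\<^esub> v \<longrightarrow> (\<exists>s\<in>S. (s \<rightarrow>\<^bsub>G\<^esub> u) \<noteq> (s \<rightarrow>\<^bsub>G\<^esub> v)))"

definition local_adjacency_dim :: "('a, 'b) pre_digraph \<Rightarrow> nat" where
  "local_adjacency_dim G = Min (card ` {S. local_adjacency_resolving G S})"

end

theory Submission
  imports Defs
begin

text \<open>
  Let \<open>V\<close> be the vertex set and \<open>\<omega>\<close> the clique number. Call \<open>U \<subseteq> V\<close> resolved if any two adjacent
  members of \<open>U\<close> are told apart by a vertex outside \<open>U\<close>, that is, if its complement \<open>S\<close> is a local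
  adjacency resolving set. The theorem follows from a resolved set \<open>U\<close> with \<open>|S| \<le> (\<omega> - 2) |U|\<close>.

  Take \<open>U\<close> of maximum size. Then no \<open>s \<in> S\<close> can be moved to \<open>U\<close> (\<open>labelled_or_twin\<close>): either \<open>s\<close> is a
  label, the only vertex of \<open>S\<close> that resolves some edge inside \<open>U\<close>, or \<open>s\<close> is a twin, adjacent to
  some \<open>v \<in> U\<close> with the same closed neighbourhood in \<open>S\<close>. Write \<open>tr v\<close> for the set of neighbours of \<open>v\<close>
  in \<open>S\<close>, and link two vertices of \<open>U\<close> if their traces are equal, or if they are adjacent and their
  traces differ in one element, which is then a label. Let \<open>C\<close> be a component of this relation.
  As in Bondy's theorem, it accounts for at most \<open>|C| - 1\<close> labels. Its twins are adjacent to each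
  other and to all of \<open>C\<close>, so there are at most \<open>\<omega> - 1\<close> of them, and at most \<open>\<omega> - 2\<close> if \<open>C\<close> has labels.
  Therefore \<open>C\<close> accounts for at most \<open>(\<omega> - 2) |C|\<close> vertices of \<open>S\<close>, unless \<open>C = {u}\<close> where \<open>u\<close> has
  \<open>\<omega> - 1\<close> twins. Such a vertex \<open>u\<close> is called tight, and there the bound fails by one.

  The missing units are found in other components. If a vertex \<open>r \<noteq> u\<close> of \<open>U\<close> is adjacent to a twin of
  the tight vertex \<open>u\<close>, then the component of \<open>r\<close> has no twins (\<open>twins_attached\<close>), so it has room to
  spare. Choosing \<open>U\<close> well among the resolved sets of maximum size ensures that there is enough
  room. First, a minimal degree sum over \<open>U\<close> and connectedness yield such an \<open>r\<close> for every tight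
  vertex (\<open>tight_has_neighbour\<close>). Secondly, a component with labels can pay for \<open>\<omega> - 2\<close> tight
  vertices, and not more are attached to it (\<open>card_attached\<close>), provided that \<open>S\<close> spans as many
  edges as possible. Thirdly, the components without labels can pay one unit for each of their
  vertices, and a set \<open>W\<close> of tight vertices has at least \<open>|W|\<close> vertices \<open>r\<close> as above
  (\<open>card_le_touching\<close>): otherwise exchanging these against one twin of each \<open>u \<in> W\<close> would give a
  larger resolved set.
\<close>

section \<open>Varying coordinates of a connected family of sets\<close>

definition varying :: "('a \<Rightarrow> 'b set) \<Rightarrow> 'a set \<Rightarrow> 'b set" where
  "varying f C = {s. \<exists>a\<in>C. \<exists>b\<in>C. s \<in> f a \<and> s \<notin> f b}"

lemma finite_varying: "finite C \<Longrightarrow> (\<And>c. c \<in> C \<Longrightarrow> finite (f c)) \<Longrightarrow> finite (varying f C)"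
  by (rule finite_subset[of _ "\<Union>c\<in>C. f c"]) (auto simp: varying_def)

text \<open>
  This is the counting step of Bondy's theorem on distinguishing sets by few elements. Let the
  family grow one member at a time, each new member differing from an old one in at most one
  coordinate \<open>s\<close>. If \<open>s\<close> starts to vary with the new member, then that member is a set not
  seen before; so a new varying coordinate always comes with a new set.
\<close>

lemma card_varying_less_card_image:
  fixes f :: "'a \<Rightarrow> 'b set"
  assumes fin: "finite C" and ne: "C \<noteq> {}" and finf: "\<And>c. c \<in> C \<Longrightarrow> finite (f c)"
    and cut: "\<And>D. D \<subseteq> C \<Longrightarrow> D \<noteq> {} \<Longrightarrow> D \<noteq> C \<Longrightarrow>
      \<exists>a\<in>D. \<exists>b\<in>C - D. f a = f b \<or> (\<exists>s. sym_diff (f a) (f b) = {s})"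
  shows "card (varying f C) < card (f ` C)"
proof -
  define P where "P D \<longleftrightarrow> D \<subseteq> C \<and> D \<noteq> {} \<and> card (varying f D) < card (f ` D)" for D
  obtain c where c: "c \<in> C" using ne by blast
  have "P {c}" using c by (simp add: P_def varying_def)
  moreover have bound: "\<forall>D. P D \<longrightarrow> card D < Suc (card C)"
    using fin by (auto simp: P_def intro: card_mono less_Suc_eq_le[THEN iffD2])
  ultimately obtain D where D: "P D" and max: "\<And>D'. P D' \<Longrightarrow> card D' \<le> card D"
    using ex_has_greatest_nat[of P "{c}" card "Suc (card C)"] by blast
  have DC: "D \<subseteq> C" and D0: "D \<noteq> {}" and lt: "card (varying f D) < card (f ` D)"
    using D by (auto simp: P_def)
  have finD: "finite D" using DC fin by (rule finite_subset)
  have "D = C"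
  proof (rule ccontr)
    assume "D \<noteq> C"
    then obtain a b where a: "a \<in> D" and b: "b \<in> C" "b \<notin> D"
      and ab: "f a = f b \<or> (\<exists>s. sym_diff (f a) (f b) = {s})"
      using cut[OF DC D0] by blast
    have finv: "finite (varying f D)" using finD DC finf by (intro finite_varying) auto
    have "card (varying f (insert b D)) < card (f ` insert b D)"
    proof (cases "f b \<in> f ` D")
      case True
      then have "varying f (insert b D) = varying f D" by (auto simp: varying_def)
      with True lt show ?thesis by (simp add: insert_absorb)
    next
      case False
      then obtain s where s: "sym_diff (f a) (f b) = {s}" using ab a by auto
      have "varying f (insert b D) \<subseteq> insert s (varying f D)"
      proof
        fix t assume "t \<in> varying f (insert b D)"
        then obtain p q where pq: "p \<in> insert b D" "q \<in> insert b D" "t \<in> f p" "t \<notin> f q"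
          by (auto simp: varying_def)
        show "t \<in> insert s (varying f D)"
        proof (cases "t = s")
          case False
          then have same: "t \<in> f a \<longleftrightarrow> t \<in> f b" using s by blast
          have "(if p = b then a else p) \<in> D" "(if q = b then a else q) \<in> D"
            using pq a by auto
          moreover have "t \<in> f (if p = b then a else p)" "t \<notin> f (if q = b then a else q)"
            using pq same by auto
          ultimately show ?thesis unfolding varying_def by blast
        qed simp
      qed
      then have "card (varying f (insert b D)) \<le> card (insert s (varying f D))"
        using finv by (intro card_mono) auto
      also have "\<dots> \<le> Suc (card (varying f D))" using finv by (simp add: card_insert_if)
      also have "\<dots> < card (f ` insert b D)" using lt False finD by simp
      finally show ?thesis .
    qed
    then have "P (insert b D)" using DC b by (auto simp: P_def)
    from max[OF this] show False using b finD by simp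
  qed
  with lt show ?thesis by simp
qed

section \<open>Graphs with bounded cliques\<close>

text \<open>
  Here \<open>\<omega>\<close> is an upper bound for the clique sizes, and connectedness has the form in which it
  enters the argument: some edge leaves every nonempty proper set of vertices.
\<close>

locale clique_bounded_graph =
  fixes V :: "'a set" and adj :: "'a \<Rightarrow> 'a \<Rightarrow> bool" (infix \<open>\<sim>\<close> 50) and \<omega> :: nat
  assumes finite_V: "finite V"
    and adj_V: "a \<sim> b \<Longrightarrow> a \<in> V"
    and adj_sym: "a \<sim> b \<Longrightarrow> b \<sim> a"
    and adj_irrefl: "\<not> a \<sim> a"
    and boundary: "\<lbrakk>K \<subseteq> V; K \<noteq> {}; K \<noteq> V\<rbrakk> \<Longrightarrow> \<exists>a\<in>K. \<exists>b\<in>V - K. a \<sim> b"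
    and clique_le: "\<lbrakk>K \<subseteq> V; \<And>a b. \<lbrakk>a \<in> K; b \<in> K; a \<noteq> b\<rbrakk> \<Longrightarrow> a \<sim> b\<rbrakk> \<Longrightarrow> card K \<le> \<omega>"
    and \<omega>_ge: "3 \<le> \<omega>"
    and \<omega>_less: "\<omega> < card V"
begin

text \<open>
  It is more convenient to speak of the complement of a local adjacency resolving set.
\<close>

definition resolved :: "'a set \<Rightarrow> bool" where
  "resolved U \<longleftrightarrow> U \<subseteq> V \<and> (\<forall>a\<in>U. \<forall>b\<in>U. a \<sim> b \<longrightarrow> (\<exists>s\<in>V - U. s \<sim> a \<longleftrightarrow> \<not> s \<sim> b))"

text \<open>
  Edges are counted as ordered pairs, hence twice.
\<close>

definition inner_edges :: "'a set \<Rightarrow> nat" where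
  "inner_edges S = card {(a, b) \<in> S \<times> S. a \<sim> b}"

definition degree :: "'a \<Rightarrow> nat" where
  "degree v = card {b. v \<sim> b}"

lemma adj_commute: "a \<sim> b \<longleftrightarrow> b \<sim> a" using adj_sym by blast

lemma adj_V2: "a \<sim> b \<Longrightarrow> b \<in> V" using adj_sym adj_V by blast

lemma finite_nbrs: "finite {b. v \<sim> b}"
  by (rule finite_subset[OF _ finite_V]) (auto dest: adj_V2)

lemma inner_edges_insert:
  assumes "x \<notin> S" "finite S"
  shows "inner_edges (insert x S) = inner_edges S + 2 * card {s \<in> S. s \<sim> x}"
proof -
  let ?N = "{s \<in> S. s \<sim> x}"
  have "{(a, b) \<in> insert x S \<times> insert x S. a \<sim> b}
      = {(a, b) \<in> S \<times> S. a \<sim> b} \<union> (Pair x ` ?N \<union> (\<lambda>s. (s, x)) ` ?N)"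
    using adj_sym adj_irrefl by auto
  moreover have "card (Pair x ` ?N \<union> (\<lambda>s. (s, x)) ` ?N) = 2 * card ?N"
    using assms by (subst card_Un_disjoint) (auto simp: card_image inj_on_def)
  moreover have "finite {(a, b) \<in> S \<times> S. a \<sim> b}"
    using assms by (auto intro: finite_subset[of _ "S \<times> S"])
  moreover have "{(a, b) \<in> S \<times> S. a \<sim> b} \<inter> (Pair x ` ?N \<union> (\<lambda>s. (s, x)) ` ?N) = {}"
    using assms by auto
  moreover have "finite (Pair x ` ?N \<union> (\<lambda>s. (s, x)) ` ?N)" using assms by simp
  ultimately show ?thesis unfolding inner_edges_def
    by (simp only: card_Un_disjoint)
qed

text \<open>
  The three criteria are needed for different purposes: maximum size makes every outside vertex
  unable to join \<open>U\<close>, many edges outside \<open>U\<close> bound the traces of the vertices near a tight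
  vertex (see \<open>card_tr_near_tight\<close>), and small degrees inside \<open>U\<close> make every tight vertex have
  such vertices near it (see \<open>tight_has_neighbour\<close>).
\<close>

lemma ex_optimal:
  "\<exists>U. resolved U \<and> (\<forall>U'. resolved U' \<longrightarrow> card U' \<le> card U)
    \<and> (\<forall>U'. resolved U' \<longrightarrow> card U' = card U \<longrightarrow> inner_edges (V - U') \<le> inner_edges (V - U))
    \<and> (\<forall>U'. resolved U' \<longrightarrow> card U' = card U \<longrightarrow> inner_edges (V - U') = inner_edges (V - U)
        \<longrightarrow> sum degree U \<le> sum degree U')"
proof -
  have fin: "finite {U. resolved U}"
    by (rule finite_subset[of _ "Pow V"]) (auto simp: resolved_def finite_V)
  have argmax: "\<exists>x\<in>A. \<forall>y\<in>A. g y \<le> g x" if "finite A" "A \<noteq> {}" for A and g :: "'a set \<Rightarrow> nat"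
    using Max_in[of "g ` A"] Max_ge[of "g ` A"] that by fastforce
  have "resolved {}" by (simp add: resolved_def)
  then obtain U1 where U1: "resolved U1" "\<forall>U'. resolved U' \<longrightarrow> card U' \<le> card U1"
    using argmax[OF fin, of card] by auto
  let ?A2 = "{U. resolved U \<and> card U = card U1}"
  have "finite ?A2" "?A2 \<noteq> {}" using U1 fin by (auto intro: rev_finite_subset[OF fin])
  then obtain U2 where U2: "U2 \<in> ?A2" "\<forall>U\<in>?A2. inner_edges (V - U) \<le> inner_edges (V - U2)"
    using argmax[of ?A2 "\<lambda>U. inner_edges (V - U)"] by blast
  let ?A3 = "{U \<in> ?A2. inner_edges (V - U) = inner_edges (V - U2)}"
  have "U2 \<in> ?A3" using U2 by simp
  then obtain U3 where "U3 \<in> ?A3" "\<And>U. U \<in> ?A3 \<Longrightarrow> sum degree U3 \<le> sum degree U"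
    using ex_has_least_nat[of "\<lambda>U. U \<in> ?A3" U2 "sum degree"] by blast
  with U1 U2 show ?thesis by (intro exI[of _ U3]) auto
qed

end

section \<open>Optimal resolved sets\<close>

locale optimal_resolved = clique_bounded_graph +
  fixes U :: "'a set"
  assumes resolved_U: "resolved U"
    and max_card: "resolved U' \<Longrightarrow> card U' \<le> card U"
    and max_inner: "\<lbrakk>resolved U'; card U' = card U\<rbrakk>
      \<Longrightarrow> inner_edges (V - U') \<le> inner_edges (V - U)"
    and min_degree: "\<lbrakk>resolved U'; card U' = card U; inner_edges (V - U') = inner_edges (V - U)\<rbrakk>
      \<Longrightarrow> sum degree U \<le> sum degree U'"
begin

definition S where "S = V - U"

definition tr :: "'a \<Rightarrow> 'a set" where "tr v = {s \<in> S. s \<sim> v}"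

text \<open>
  A label cannot leave \<open>S\<close>, because some edge inside \<open>U\<close> is resolved by it alone.
\<close>

definition label :: "'a \<Rightarrow> bool" where
  "label s \<longleftrightarrow> (\<exists>a\<in>U. \<exists>b\<in>U. a \<sim> b \<and> sym_diff (tr a) (tr b) = {s})"

text \<open>
  Vertices with equal traces are linked as well, adjacent or not: all vertices of \<open>U\<close> that share
  the same twins then lie in one component, and no twin is counted for two components.
\<close>

definition step :: "'a \<Rightarrow> 'a \<Rightarrow> bool" where
  "step a b \<longleftrightarrow> a \<in> U \<and> b \<in> U \<and>
    (tr a = tr b \<or> a \<sim> b \<and> (\<exists>s. sym_diff (tr a) (tr b) = {s}))"

definition comp_of :: "'a \<Rightarrow> 'a set" where
  "comp_of u = {v. step\<^sup>*\<^sup>* u v}"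

text \<open>
  For adjacent \<open>v\<close> and \<open>s\<close>, the equation \<open>tr v = insert s (tr s)\<close> says that \<open>v\<close> and \<open>s\<close> have the same
  closed neighbourhood within \<open>S\<close>, so \<open>s\<close> cannot join \<open>v\<close> in \<open>U\<close>.
\<close>

definition twins :: "'a set \<Rightarrow> 'a set" where
  "twins C = {s \<in> S. \<not> label s \<and> (\<exists>v\<in>C. v \<sim> s \<and> tr v = insert s (tr s))}"

text \<open>
  The vertex forms one of the components in which labels and twins exceed \<open>(\<omega> - 2) * card (comp_of u)\<close>,
  by one; there are no other such components.
\<close>

definition tight :: "'a \<Rightarrow> bool" where
  "tight u \<longleftrightarrow> u \<in> U \<and> comp_of u = {u} \<and> card (twins {u}) = \<omega> - 1"

lemma U_V: "U \<subseteq> V" using resolved_U by (simp add: resolved_def)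
lemma finite_U: "finite U" using U_V finite_V finite_subset by blast
lemma finite_S: "finite S" using finite_V by (simp add: S_def)
lemma S_V: "s \<in> S \<Longrightarrow> s \<in> V" by (simp add: S_def)
lemma S_U: "s \<in> S \<Longrightarrow> s \<notin> U" by (simp add: S_def)
lemma tr_S: "tr v \<subseteq> S" by (auto simp: tr_def)
lemma finite_tr: "finite (tr v)" using tr_S finite_S finite_subset by blast
lemma finite_twins: "finite (twins C)" using finite_S by (simp add: twins_def)
lemma card_V: "card V = card U + card S"
  using U_V finite_V by (simp add: S_def card_Diff_subset finite_U card_mono)

lemma tr_neq: "a \<in> U \<Longrightarrow> b \<in> U \<Longrightarrow> a \<sim> b \<Longrightarrow> tr a \<noteq> tr b"
  using resolved_U unfolding resolved_def tr_def S_def by blast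

section \<open>Components of linked vertices\<close>

lemma step_sym: "step a b \<Longrightarrow> step b a"
  using adj_sym unfolding step_def by (metis Un_commute)

lemma steps_sym: "step\<^sup>*\<^sup>* a b \<Longrightarrow> step\<^sup>*\<^sup>* b a"
  by (induction rule: rtranclp_induct) (auto intro: converse_rtranclp_into_rtranclp step_sym)

lemma comp_self: "u \<in> comp_of u" by (simp add: comp_of_def)

lemma comp_eq: "v \<in> comp_of u \<Longrightarrow> comp_of v = comp_of u"
  unfolding comp_of_def using steps_sym[of u v] rtranclp_trans[of step u v]
    rtranclp_trans[of step v u] by auto

lemma comp_subset: "u \<in> U \<Longrightarrow> comp_of u \<subseteq> U"
proof
  fix v assume "u \<in> U" "v \<in> comp_of u"
  then have "step\<^sup>*\<^sup>* u v" by (simp add: comp_of_def)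
  then show "v \<in> U" using \<open>u \<in> U\<close> by (induction rule: rtranclp_induct) (auto simp: step_def)
qed

lemma step_comp: "a \<in> comp_of u \<Longrightarrow> step a b \<Longrightarrow> b \<in> comp_of u"
  by (simp add: comp_of_def)

lemma comp_same_tr: "a \<in> U \<Longrightarrow> b \<in> U \<Longrightarrow> tr a = tr b \<Longrightarrow> b \<in> comp_of a"
  by (auto simp: comp_of_def step_def)

lemma comp_cut:
  assumes D: "D \<subseteq> comp_of u" "D \<noteq> {}" "D \<noteq> comp_of u"
  shows "\<exists>a\<in>D. \<exists>b\<in>comp_of u - D. step a b"
proof (rule ccontr)
  assume none: "\<not> ?thesis"
  obtain a where a: "a \<in> D" using D by blast
  have "b \<in> D" if "step\<^sup>*\<^sup>* a b" for b
    using that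
  proof (induction rule: rtranclp_induct)
    case (step b c)
    have "b \<in> comp_of u" using step.IH D(1) by blast
    then have "c \<in> comp_of u" using step.hyps(2) by (rule step_comp)
    then show ?case using none step by blast
  qed (rule a)
  then have "comp_of a \<subseteq> D" by (auto simp: comp_of_def)
  moreover have "comp_of a = comp_of u" using a D(1) comp_eq by blast
  ultimately show False using D by blast
qed

text \<open>
  The trace changes by at most one element along a link, so the link along which the coordinate \<open>s\<close>
  changes is an edge whose ends differ in \<open>s\<close> alone.
\<close>

lemma varying_step:
  assumes s: "s \<in> varying tr (comp_of u)"
  shows "\<exists>a\<in>comp_of u. \<exists>b\<in>comp_of u. a \<sim> b \<and> sym_diff (tr a) (tr b) = {s}"
proof -
  let ?D = "{a \<in> comp_of u. s \<in> tr a}"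
  have "?D \<noteq> {}" "?D \<noteq> comp_of u" using s by (auto simp: varying_def)
  then obtain a b where ab: "a \<in> ?D" "b \<in> comp_of u - ?D" "step a b"
    using comp_cut[of ?D u] by blast
  then have d: "s \<in> sym_diff (tr a) (tr b)" by blast
  then have "tr a \<noteq> tr b" by blast
  then obtain t where "a \<sim> b" "sym_diff (tr a) (tr b) = {t}"
    using ab(3) unfolding step_def by blast
  with d have "a \<sim> b \<and> sym_diff (tr a) (tr b) = {s}" by simp
  with ab show ?thesis by blast
qed

lemma varying_label: "u \<in> U \<Longrightarrow> s \<in> varying tr (comp_of u) \<Longrightarrow> label s"
  using varying_step[of s u] comp_subset[of u] unfolding label_def by blast

lemma nonlabel_const:
  "\<lbrakk>u \<in> U; \<not> label y; y \<in> S; a \<in> comp_of u; y \<sim> a; b \<in> comp_of u\<rbrakk> \<Longrightarrow> y \<sim> b"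
  using varying_label[of u y] unfolding varying_def tr_def by blast

lemma label_varying: "label s \<Longrightarrow> \<exists>u\<in>U. s \<in> varying tr (comp_of u)"
proof -
  assume "label s"
  then obtain a b where ab: "a \<in> U" "b \<in> U" "a \<sim> b" "sym_diff (tr a) (tr b) = {s}"
    by (auto simp: label_def)
  then have "b \<in> comp_of a" using comp_self step_comp[of a a b] by (auto simp: step_def)
  then show ?thesis using ab comp_self[of a] unfolding varying_def by blast
qed

lemma finite_comp: "u \<in> U \<Longrightarrow> finite (comp_of u)"
  using comp_subset finite_U finite_subset by blast

lemma finite_varying_comp: "u \<in> U \<Longrightarrow> finite (varying tr (comp_of u))"
  by (intro finite_varying finite_comp finite_tr)

lemma card_varying_comp:
  assumes "u \<in> U"
  shows "card (varying tr (comp_of u)) < card (comp_of u)"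
proof -
  have "card (varying tr (comp_of u)) < card (tr ` comp_of u)"
  proof (rule card_varying_less_card_image)
    show "finite (comp_of u)" using assms by (rule finite_comp)
    show "comp_of u \<noteq> {}" using comp_self by blast
    show "finite (tr c)" for c by (rule finite_tr)
    fix D assume "D \<subseteq> comp_of u" "D \<noteq> {}" "D \<noteq> comp_of u"
    then show "\<exists>a\<in>D. \<exists>b\<in>comp_of u - D. tr a = tr b \<or> (\<exists>s. sym_diff (tr a) (tr b) = {s})"
      using comp_cut[of D u] unfolding step_def by blast
  qed
  also have "\<dots> \<le> card (comp_of u)" using assms finite_comp card_image_le by blast
  finally show ?thesis .
qed

text \<open>
  By maximality of \<open>U\<close>, adding \<open>s\<close> to \<open>U\<close> leaves some adjacent pair unresolved. Either the pair lies
  in \<open>U\<close>, and \<open>s\<close> was the only vertex to resolve it, or \<open>s\<close> belongs to the pair.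
\<close>

lemma labelled_or_twin:
  assumes s: "s \<in> S"
  shows "\<exists>u\<in>U. s \<in> varying tr (comp_of u) \<union> twins (comp_of u)"
proof (cases "label s")
  case True
  then show ?thesis using label_varying by blast
next
  case nl: False
  have "\<not> resolved (insert s U)"
    using max_card[of "insert s U"] s finite_U by (auto simp: S_def)
  moreover have "insert s U \<subseteq> V" using s U_V by (auto simp: S_def)
  ultimately obtain a b where ab: "a \<in> insert s U" "b \<in> insert s U" "a \<sim> b"
      and same: "\<And>t. t \<in> V - insert s U \<Longrightarrow> t \<sim> a \<longleftrightarrow> t \<sim> b"
    unfolding resolved_def by blast
  have sub: "sym_diff (tr a) (tr b) \<subseteq> {s}"
    using same by (auto simp: tr_def S_def)
  have "\<exists>v\<in>U. v \<sim> s \<and> tr v - {s} = tr s - {s}"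
  proof (cases "a = s \<or> b = s")
    case True
    then show ?thesis using ab sub adj_irrefl adj_sym by blast
  next
    case False
    then have "a \<in> U" "b \<in> U" using ab by auto
    moreover from this have "sym_diff (tr a) (tr b) = {s}" using sub tr_neq ab by blast
    ultimately show ?thesis using nl ab by (auto simp: label_def)
  qed
  then obtain v where v: "v \<in> U" "v \<sim> s" "tr v - {s} = tr s - {s}" by blast
  have "s \<in> tr v" "s \<notin> tr s" using v s adj_sym adj_irrefl by (auto simp: tr_def)
  then have "tr v = insert s (tr s)" using v by blast
  then have "s \<in> twins (comp_of v)" using nl s v comp_self by (auto simp: twins_def)
  then show ?thesis using v by blast
qed

text \<open>
  A twin is no label, so its adjacency to the vertices of a component does not change along links.
\<close>

lemma twins_adj_comp:
  assumes "u \<in> U" "y \<in> twins (comp_of u)" "c \<in> comp_of u"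
  shows "y \<sim> c"
  using assms nonlabel_const[of u y _ c] adj_sym unfolding twins_def by blast

text \<open>
  If \<open>y\<close> is a twin of \<open>v\<close>, then \<open>y\<close> is adjacent to all of \<open>tr v\<close> except itself, and this trace contains
  every other twin of the component.
\<close>

lemma twins_adj:
  assumes "u \<in> U" "y \<in> twins (comp_of u)" "z \<in> twins (comp_of u)" "y \<noteq> z"
  shows "y \<sim> z"
proof -
  obtain v where v: "v \<in> comp_of u" "tr v = insert y (tr y)"
    using assms by (auto simp: twins_def)
  have "z \<in> S" using assms by (simp add: twins_def)
  then have "z \<in> tr v" using twins_adj_comp[OF assms(1,3) v(1)] by (simp add: tr_def)
  then have "z \<in> tr y" using v assms(4) by simp
  then show ?thesis using adj_sym by (simp add: tr_def)
qed

lemma card_twins_clique: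
  assumes u: "u \<in> U" and B: "B \<subseteq> comp_of u" and cl: "\<And>a b. a \<in> B \<Longrightarrow> b \<in> B \<Longrightarrow> a \<noteq> b \<Longrightarrow> a \<sim> b"
  shows "card (twins (comp_of u)) + card B \<le> \<omega>"
proof -
  have BU: "B \<subseteq> U" using B comp_subset u by blast
  have "card (twins (comp_of u) \<union> B) \<le> \<omega>"
  proof (rule clique_le)
    show "twins (comp_of u) \<union> B \<subseteq> V" using BU U_V S_V by (auto simp: twins_def)
    fix a b assume "a \<in> twins (comp_of u) \<union> B" "b \<in> twins (comp_of u) \<union> B" "a \<noteq> b"
    then show "a \<sim> b" using twins_adj[OF u] twins_adj_comp[OF u] B cl adj_sym by blast
  qed
  moreover have "twins (comp_of u) \<inter> B = {}" using BU S_U by (auto simp: twins_def)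
  ultimately show ?thesis
    using finite_twins finite_subset[OF BU finite_U] by (simp add: card_Un_disjoint)
qed

lemma card_twins_le:
  assumes "u \<in> U" shows "card (twins (comp_of u)) + 1 \<le> \<omega>"
  using card_twins_clique[of u "{u}"] assms comp_self by simp

text \<open>
  A component with a label contains an edge, and both ends extend the clique of twins.
\<close>

lemma card_twins_varying:
  assumes "u \<in> U" "varying tr (comp_of u) \<noteq> {}"
  shows "card (twins (comp_of u)) + 2 \<le> \<omega>"
proof -
  obtain s where "s \<in> varying tr (comp_of u)" using assms by blast
  then obtain a b where "a \<in> comp_of u" "b \<in> comp_of u" "a \<sim> b" using varying_step by blast
  moreover from this have "a \<noteq> b" using adj_irrefl by blast
  ultimately show ?thesis using card_twins_clique[of u "{a, b}"] assms(1) adj_sym by auto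
qed

section \<open>Tight vertices\<close>

lemma tight_U: "tight u \<Longrightarrow> u \<in> U"
  by (simp add: tight_def)

text \<open>
  The vertex \<open>u\<close> and its \<open>\<omega> - 1\<close> twins form a maximum clique. Another neighbour of \<open>u\<close> in \<open>S\<close> would
  be a neighbour of all the twins and enlarge it. So the clique is \<open>insert u (tr u)\<close>, and its
  vertices have no neighbours in \<open>S\<close> outside the clique.
\<close>

lemma tight_tr:
  assumes t: "tight u"
  shows "tr u = twins {u}"
proof
  show "twins {u} \<subseteq> tr u"
  proof
    fix s assume "s \<in> twins {u}"
    then have "s \<in> S" "u \<sim> s" by (auto simp: twins_def)
    then show "s \<in> tr u" using adj_commute[of u s] by (simp add: tr_def)
  qed
  have u: "u \<in> U" and C: "comp_of u = {u}" and card: "card (twins {u}) = \<omega> - 1"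
    using t by (auto simp: tight_def)
  show "tr u \<subseteq> twins {u}"
  proof
    fix s assume s: "s \<in> tr u"
    show "s \<in> twins {u}"
    proof (rule ccontr)
      assume n: "s \<notin> twins {u}"
      have su: "s \<sim> u" "s \<in> S" using s by (auto simp: tr_def)
      have sy: "s \<sim> y" if "y \<in> twins {u}" for y
      proof -
        have "tr u = insert y (tr y)" using that by (simp add: twins_def)
        then show ?thesis using s that n by (auto simp: tr_def)
      qed
      have "card (insert s (insert u (twins {u}))) \<le> \<omega>"
      proof (rule clique_le)
        show "insert s (insert u (twins {u})) \<subseteq> V"
          using su u U_V S_V by (auto simp: twins_def)
        fix a b assume "a \<in> insert s (insert u (twins {u}))"
          "b \<in> insert s (insert u (twins {u}))" "a \<noteq> b"
        then show "a \<sim> b"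
          using su sy adj_sym twins_adj[OF u] twins_adj_comp[OF u] unfolding C by blast
      qed
      moreover have "u \<notin> twins {u}" "s \<noteq> u" using u S_U su by (auto simp: twins_def)
      ultimately show False using n card finite_twins \<omega>_ge by simp
    qed
  qed
qed

lemma card_tight: "tight u \<Longrightarrow> card (tr u) = \<omega> - 1"
  using tight_tr by (simp add: tight_def)

lemma tight_nonlabel:
  assumes "tight u" "x \<in> tr u" shows "\<not> label x"
  using assms(2) unfolding tight_tr[OF assms(1)] by (simp add: twins_def)

lemma tight_twin:
  assumes "tight u" "x \<in> tr u" shows "tr u = insert x (tr x)"
proof -
  have "x \<in> twins {u}" using assms tight_tr by blast
  then show ?thesis by (simp add: twins_def)
qed

lemma tight_adj_S:
  assumes "tight u" "x \<in> tr u" "s \<in> S" "s \<noteq> x"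
  shows "s \<sim> x \<longleftrightarrow> s \<in> tr u"
  unfolding tight_twin[OF assms(1,2)] using assms(3,4) by (simp add: tr_def)

lemma tight_unique: "\<lbrakk>tight u; v \<in> U; tr v = tr u\<rbrakk> \<Longrightarrow> v = u"
  using comp_same_tr[of u v] by (auto simp: tight_def)

lemma tight_disjoint: "\<lbrakk>tight u; tight v; x \<in> tr u; x \<in> tr v\<rbrakk> \<Longrightarrow> u = v"
  by (metis tight_twin tight_unique tight_U)

lemma tight_clique_maximal:
  assumes t: "tight u" and v: "v \<sim> u" and all: "\<And>x. x \<in> tr u \<Longrightarrow> v \<sim> x"
  shows False
proof -
  have cl: "x \<sim> y" if "x \<in> tr u" "y \<in> tr u" "x \<noteq> y" for x y
    using that tight_adj_S[OF t] tr_S by blast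
  have "card (insert v (insert u (tr u))) \<le> \<omega>"
  proof (rule clique_le)
    show "insert v (insert u (tr u)) \<subseteq> V"
      using adj_V[OF v] tight_U[OF t] U_V tr_S S_V by blast
    fix a b assume "a \<in> insert v (insert u (tr u))" "b \<in> insert v (insert u (tr u))" "a \<noteq> b"
    moreover have "x \<sim> u" if "x \<in> tr u" for x using that by (simp add: tr_def)
    ultimately show "a \<sim> b" using v all cl adj_sym by blast
  qed
  moreover have "v \<noteq> u" "v \<notin> tr u" "u \<notin> tr u"
    using v all adj_irrefl by (auto simp: tr_def)
  ultimately show False using card_tight[OF t] finite_tr \<omega>_ge by simp
qed

lemma tight_other:
  assumes "tight u"
  shows "\<exists>y\<in>tr u. y \<noteq> x"
proof (rule ccontr)
  assume "\<not> ?thesis"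
  then have "card (tr u) \<le> card {x}" by (intro card_mono) auto
  then show False using card_tight[OF assms] \<omega>_ge by simp
qed

section \<open>Exchanges that keep a set resolved\<close>

text \<open>
  Since \<open>x\<close> is no label, every edge of \<open>U\<close> stays resolved when \<open>x\<close> leaves \<open>S\<close>. A vertex \<open>v\<close> of \<open>U\<close> that is adjacent to \<open>x\<close>
  but not separated from it would be adjacent to the whole maximum clique.
\<close>

lemma resolved_swap:
  assumes t: "tight u" and x: "x \<in> tr u"
  shows "resolved (insert x (U - {u}))"
proof -
  have xS: "x \<in> S" and xu: "x \<sim> u" using x by (auto simp: tr_def)
  have u: "u \<in> U" using t by (rule tight_U)
  let ?U = "insert x (U - {u})"
  have VU: "V - ?U = insert u (S - {x})" using u U_V S_U[OF xS] by (auto simp: S_def)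
  have new: "\<exists>s\<in>V - ?U. s \<sim> x \<longleftrightarrow> \<not> s \<sim> v" if v: "v \<in> U" "v \<sim> x" for v
  proof (rule ccontr)
    assume "\<not> ?thesis"
    then have same: "s \<sim> x \<longleftrightarrow> s \<sim> v" if "s \<in> insert u (S - {x})" for s
      unfolding VU using that by blast
    have "v \<sim> u" using same[of u] adj_sym xu by blast
    moreover have "v \<sim> y" if "y \<in> tr u" for y
    proof (cases "y = x")
      case False
      then show ?thesis using same[of y] tight_adj_S[OF t x, of y] that tr_S adj_sym by blast
    qed (use v in simp)
    ultimately show False using tight_clique_maximal[OF t] by blast
  qed
  show ?thesis unfolding resolved_def
  proof (intro conjI ballI impI)
    show "?U \<subseteq> V" using U_V S_V xS by auto
    fix a b assume a: "a \<in> ?U" and b: "b \<in> ?U" and ab: "a \<sim> b"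
    show "\<exists>s\<in>V - ?U. s \<sim> a \<longleftrightarrow> \<not> s \<sim> b"
    proof (cases "a = x \<or> b = x")
      case True
      then show ?thesis using new a b ab adj_sym adj_irrefl by blast
    next
      case False
      then have U: "a \<in> U" "b \<in> U" using a b by auto
      have "sym_diff (tr a) (tr b) \<noteq> {x}"
        using tight_nonlabel[OF t x] U ab by (auto simp: label_def)
      then obtain s where "s \<in> sym_diff (tr a) (tr b)" "s \<noteq> x"
        using tr_neq[OF U ab] by blast
      then show ?thesis unfolding VU by (auto simp: tr_def)
    qed
  qed
qed

text \<open>
  Several tight vertices receive a twin into \<open>U\<close> at the same time, while the vertices of \<open>R\<close> leave
  \<open>U\<close> and separate every tight vertex from its twin. The assumptions \<open>old\<close> and \<open>new\<close> ask for what
  this does not settle; the promoted twins themselves are pairwise nonadjacent because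
  the traces of different tight vertices are disjoint.
\<close>

lemma resolved_exchange:
  assumes W: "\<And>u. u \<in> W \<Longrightarrow> tight u" and R: "R \<subseteq> U" "W \<inter> R = {}"
    and x: "\<And>u. u \<in> W \<Longrightarrow> x u \<in> tr u"
    and sep: "\<And>u. u \<in> W \<Longrightarrow> \<exists>r\<in>R. r \<sim> u \<longleftrightarrow> \<not> r \<sim> x u"
    and old: "\<And>a b. \<lbrakk>a \<in> U - R; b \<in> U - R; a \<sim> b\<rbrakk> \<Longrightarrow> \<not> sym_diff (tr a) (tr b) \<subseteq> x ` W"
    and new: "\<And>u v. \<lbrakk>u \<in> W; v \<in> U - R; v \<noteq> u; v \<sim> x u\<rbrakk>
      \<Longrightarrow> \<exists>s\<in>S - x ` W. s \<sim> x u \<longleftrightarrow> \<not> s \<sim> v"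
  shows "resolved ((U - R) \<union> x ` W) \<and> card ((U - R) \<union> x ` W) + card R = card U + card W"
proof -
  let ?U = "(U - R) \<union> x ` W"
  have xS: "x ` W \<subseteq> S" using x tr_S by blast
  have VU: "V - ?U = (S - x ` W) \<union> R" using R(1) U_V xS by (auto simp: S_def)
  have nonadj: "\<not> x u \<sim> x v" if "u \<in> W" "v \<in> W" for u v
  proof
    assume a: "x u \<sim> x v"
    then have "x u \<noteq> x v" using adj_irrefl by auto
    then have "x u \<in> tr v" using tight_adj_S[OF W[OF that(2)] x[OF that(2)], of "x u"] a xS that by blast
    then have "u = v" using tight_disjoint[OF W W] x that by blast
    with a show False using adj_irrefl by simp
  qed
  have new': "\<exists>s\<in>V - ?U. s \<sim> x u \<longleftrightarrow> \<not> s \<sim> v" if "u \<in> W" "v \<in> U - R" "v \<sim> x u" for u v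
  proof (cases "v = u")
    case True
    then show ?thesis using sep[OF that(1)] unfolding VU by blast
  next
    case False
    then show ?thesis using new[OF that(1,2)] that(3) unfolding VU by blast
  qed
  have "resolved ?U" unfolding resolved_def
  proof (intro conjI ballI impI)
    show "?U \<subseteq> V" using U_V S_V xS by auto
    fix a b assume a: "a \<in> ?U" and b: "b \<in> ?U" and ab: "a \<sim> b"
    consider "a \<in> U - R" "b \<in> U - R" | u where "u \<in> W" "a = x u" "b \<in> U - R"
      | u where "u \<in> W" "b = x u" "a \<in> U - R"
      using a b ab nonadj by blast
    then show "\<exists>s\<in>V - ?U. s \<sim> a \<longleftrightarrow> \<not> s \<sim> b"
    proof cases
      case 1
      then obtain s where "s \<in> sym_diff (tr a) (tr b)" "s \<notin> x ` W" using old ab by blast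
      then show ?thesis unfolding VU by (auto simp: tr_def)
    next
      case 2
      then show ?thesis using new'[of u b] ab adj_sym by blast
    next
      case 3
      then show ?thesis using new'[of u a] ab by blast
    qed
  qed
  moreover have "inj_on x W"
  proof (rule inj_onI)
    fix u v assume uv: "u \<in> W" "v \<in> W" "x u = x v"
    then show "u = v" using tight_disjoint[OF W W, of u v "x u"] x[of u] x[of v] by simp
  qed
  moreover from this have "card (x ` W) = card W" by (rule card_image)
  moreover have "card ?U = card (U - R) + card (x ` W)"
    using finite_U finite_subset[OF xS finite_S] xS S_U by (intro card_Un_disjoint) auto
  moreover have "card (U - R) + card R = card U"
    using R(1) finite_U card_mono[OF finite_U R(1)] by (simp add: card_Diff_subset finite_subset)
  ultimately show ?thesis by simp
qed

lemma tight_separated: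
  assumes t: "tight u" and ry: "y \<in> tr u" "r \<sim> y"
  shows "\<exists>x\<in>tr u. r \<sim> u \<longleftrightarrow> \<not> r \<sim> x"
  using tight_clique_maximal[OF t, of r] ry by blast

text \<open>
  The maximum clique is not the whole graph, so some edge leaves it. If only \<open>u\<close> had outside
  neighbours, then \<open>u\<close> would have larger degree than each of its twins, and swapping \<open>u\<close> with a twin
  would decrease the degree sum of \<open>U\<close> without changing its size or the number of edges in \<open>S\<close>.
\<close>

lemma tight_has_neighbour:
  assumes t: "tight u"
  shows "\<exists>r\<in>U. r \<noteq> u \<and> (\<exists>y\<in>tr u. r \<sim> y)"
proof (rule ccontr)
  assume none: "\<not> ?thesis"
  let ?K = "insert u (tr u)"
  have u: "u \<in> U" using t by (rule tight_U)
  have uQ: "u \<notin> tr u" using u S_U tr_S by blast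
  have cK: "card ?K = \<omega>" using uQ card_tight[OF t] finite_tr \<omega>_ge by simp
  have KV: "?K \<subseteq> V" using u U_V tr_S S_V by blast
  have nbrs: "{b. x \<sim> b} \<subseteq> ?K" if x: "x \<in> tr u" for x
  proof
    fix b assume "b \<in> {b. x \<sim> b}"
    then have b: "b \<sim> x" "b \<in> V" "b \<noteq> x" using adj_sym adj_V2 adj_irrefl by blast+
    then show "b \<in> ?K" using none x tight_adj_S[OF t x, of b] by (auto simp: S_def)
  qed
  have "?K \<noteq> V" using cK \<omega>_less by auto
  then obtain a z where az: "a \<in> ?K" "z \<in> V - ?K" "a \<sim> z" using boundary[OF KV] by blast
  then have uz: "u \<sim> z" using nbrs by blast
  obtain x where x: "x \<in> tr u" using tight_other[OF t] by blast
  have xS: "x \<in> S" "x \<noteq> u" using x tr_S uQ by auto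
  let ?U = "insert x (U - {u})"
  have xU: "x \<notin> U" using xS S_U by blast
  have "card ?U = card U" using xU finite_U card_Suc_Diff1[OF finite_U u] by simp
  moreover have "inner_edges (V - ?U) = inner_edges (V - U)"
  proof -
    have "V - ?U = insert u (S - {x})" using u U_V xS by (auto simp: S_def)
    moreover have "V - U = insert x (S - {x})" using xS by (auto simp: S_def)
    moreover have "{s \<in> S - {x}. s \<sim> u} = tr u - {x}" by (auto simp: tr_def)
    moreover have "{s \<in> S - {x}. s \<sim> x} = tr u - {x}"
      using tight_adj_S[OF t x] tr_S by blast
    ultimately show ?thesis
      using inner_edges_insert[of u "S - {x}"] inner_edges_insert[of x "S - {x}"]
        finite_S S_U u by auto
  qed
  ultimately have "sum degree U \<le> sum degree ?U"
    using min_degree resolved_swap[OF t x] by blast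
  moreover have "sum degree ?U = degree x + sum degree (U - {u})" using xU finite_U by simp
  moreover have "sum degree U = degree u + sum degree (U - {u})"
    by (rule sum.remove[OF finite_U u])
  ultimately have le: "degree u \<le> degree x" by simp
  have "degree x \<le> card (?K - {x})"
    unfolding degree_def using nbrs[OF x] adj_irrefl finite_tr by (intro card_mono) auto
  also have "\<dots> < \<omega>" using cK x finite_tr card_Diff1_less[of ?K x] by simp
  also have "\<omega> = card (insert z (tr u))"
    using az card_tight[OF t] finite_tr \<omega>_ge by simp
  also have "\<dots> \<le> degree u" unfolding degree_def
    using uz finite_nbrs adj_sym unfolding tr_def by (intro card_mono) blast+
  finally show False using le by simp
qed

text \<open>
  Some element \<open>x\<close> of the trace of \<open>u\<close> is separated from \<open>u\<close> by \<open>r\<close>, so \<open>x\<close> and \<open>r\<close> can be exchanged.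
  In \<open>S\<close> this replaces the \<open>\<omega> - 2\<close> edges at \<open>x\<close> by the edges from \<open>r\<close> to \<open>S - {x}\<close>, of which there can
  be no more, since \<open>S\<close> has the maximum number of edges.
\<close>

lemma card_tr_near_tight:
  assumes t: "tight u" and r: "r \<in> U" "r \<noteq> u" and y: "y \<in> tr u" "r \<sim> y"
  shows "card (tr r) \<le> \<omega> - 1"
proof -
  obtain x where x: "x \<in> tr u" and sep: "r \<sim> u \<longleftrightarrow> \<not> r \<sim> x"
    using tight_separated[OF t y] by blast
  have u: "u \<in> U" using t by (rule tight_U)
  have xS: "x \<in> S" using x tr_S by blast
  let ?U = "(U - {r}) \<union> (\<lambda>_. x) ` {u}"
  have res: "resolved ?U \<and> card ?U + card {r} = card U + card {u}"
  proof (rule resolved_exchange)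
    show "\<exists>r'\<in>{r}. r' \<sim> v \<longleftrightarrow> \<not> r' \<sim> x" if "v \<in> {u}" for v using sep that by blast
    fix a b assume ab: "a \<in> U - {r}" "b \<in> U - {r}" "a \<sim> b"
    then have "sym_diff (tr a) (tr b) \<noteq> {x}"
      using tight_nonlabel[OF t x] by (auto simp: label_def)
    then show "\<not> sym_diff (tr a) (tr b) \<subseteq> (\<lambda>_. x) ` {u}" using tr_neq ab by blast
  next
    fix u' v assume "u' \<in> {u}" and v: "v \<in> U - {r}" "v \<noteq> u'" "v \<sim> x"
    then have "tr v \<noteq> tr u" using tight_unique[OF t] by blast
    moreover have "x \<in> tr v" using v xS adj_commute[of x v] by (simp add: tr_def)
    moreover obtain s where "s \<in> sym_diff (tr v) (tr u)" using \<open>tr v \<noteq> tr u\<close> by blast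
    ultimately have "s \<noteq> x" "s \<in> sym_diff (tr v) (tr u)" using x by auto
    then show "\<exists>s\<in>S - (\<lambda>_. x) ` {u}. s \<sim> x \<longleftrightarrow> \<not> s \<sim> v"
      using tight_adj_S[OF t x, of s] by (auto simp: tr_def)
  qed (use t r x in auto)
  have "inner_edges (V - ?U) \<le> inner_edges (V - U)"
    using max_inner res by simp
  moreover have "V - ?U = insert r (S - {x})" using r U_V xS S_U by (auto simp: S_def)
  moreover have "V - U = insert x (S - {x})" using xS by (auto simp: S_def)
  moreover have "{s \<in> S - {x}. s \<sim> r} = tr r - {x}" by (auto simp: tr_def)
  moreover have "{s \<in> S - {x}. s \<sim> x} = tr u - {x}" using tight_adj_S[OF t x] tr_S by blast
  ultimately have "card (tr r - {x}) \<le> card (tr u - {x})"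
    using inner_edges_insert[of r "S - {x}"] inner_edges_insert[of x "S - {x}"]
      finite_S S_U r(1) by auto
  then have le: "card (tr r - {x}) \<le> \<omega> - 2" using x card_tight[OF t] finite_tr by simp
  show ?thesis
  proof (cases "x \<in> tr r")
    case True
    then show ?thesis using le finite_tr \<omega>_ge by simp
  next
    case False
    then show ?thesis using le by simp
  qed
qed

section \<open>Counting by components\<close>

definition touches :: "'a \<Rightarrow> 'a \<Rightarrow> bool" where
  "touches r u \<longleftrightarrow> r \<in> U \<and> r \<noteq> u \<and> (\<exists>y\<in>tr u. r \<sim> y)"

definition attached :: "'a set \<Rightarrow> 'a set" where
  "attached C = {u. tight u \<and> (\<exists>r\<in>C. touches r u)}"

lemma finite_tight: "finite {u. tight u}"
  using tight_U finite_U by (blast intro: finite_subset)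

lemma finite_attached: "finite (attached C)"
  by (rule finite_subset[OF _ finite_tight]) (auto simp: attached_def)

lemma tight_comp:
  assumes "tight u" "u \<in> comp_of c" shows "comp_of c = {u}"
  using comp_eq[OF assms(2)] assms(1) by (simp add: tight_def)

lemma attached_notin:
  assumes c: "c \<in> U" and u: "u \<in> attached (comp_of c)"
  shows "u \<notin> comp_of c"
proof
  assume "u \<in> comp_of c"
  then have "comp_of c = {u}" using u tight_comp by (simp add: attached_def)
  then show False using u by (simp add: attached_def touches_def)
qed

text \<open>
  The elements of the trace of a tight vertex are no labels, so if one vertex of a component sees
  such an element then all of them do.
\<close>

lemma attached_adj_all:
  assumes c: "c \<in> U" and u: "u \<in> attached (comp_of c)"
  shows "\<exists>y\<in>tr u. \<forall>v\<in>comp_of c. y \<in> tr v"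
proof -
  obtain r y where r: "r \<in> comp_of c" and y: "y \<in> tr u" "r \<sim> y" and t: "tight u"
    using u by (auto simp: attached_def touches_def)
  have yS: "y \<in> S" using y tr_S by blast
  have "y \<sim> v" if "v \<in> comp_of c" for v
    using nonlabel_const[OF c tight_nonlabel[OF t y(1)] yS r _ that] y(2) adj_sym by blast
  then have "\<forall>v\<in>comp_of c. y \<in> tr v" using yS by (simp add: tr_def)
  then show ?thesis using y(1) by blast
qed

text \<open>
  This gives components near tight vertices room to pay for them. A twin \<open>s\<close> in such a component
  would be adjacent or equal to an element of the trace of the tight vertex \<open>u\<close>, hence belong to
  that trace, and the component would be that of \<open>u\<close>.
\<close>

lemma twins_attached:
  assumes c: "c \<in> U" and u: "u \<in> attached (comp_of c)"
  shows "twins (comp_of c) = {}"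
proof (rule ccontr)
  assume "twins (comp_of c) \<noteq> {}"
  then obtain s v where s: "s \<in> S" "v \<in> comp_of c" "tr v = insert s (tr s)"
    by (auto simp: twins_def)
  have t: "tight u" using u by (simp add: attached_def)
  obtain y where y: "y \<in> tr u" "y \<in> tr v" using attached_adj_all[OF c u] s(2) by blast
  have "y = s \<or> s \<sim> y"
    using y(2) s(3) adj_sym by (auto simp: tr_def)
  then have su: "s \<in> tr u" using y(1) tight_adj_S[OF t y(1) s(1)] by blast
  then have "tr v = tr u" using tight_twin[OF t su] s(3) by simp
  then have "v = u" using tight_unique[OF t] comp_subset[OF c] s(2) by blast
  then show False using attached_notin[OF c u] s(2) by blast
qed

text \<open>
  Different tight vertices attached to the component contribute different elements to the
  common part of all traces. Since the coordinate \<open>s\<close> varies, some trace, which has at most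
  \<open>\<omega> - 1\<close> elements, is not contained in this common part.
\<close>

lemma card_attached:
  assumes c: "c \<in> U" and var: "varying tr (comp_of c) \<noteq> {}"
  shows "card (attached (comp_of c)) \<le> \<omega> - 2"
proof (cases "attached (comp_of c) = {}")
  case False
  let ?A = "attached (comp_of c)"
  obtain s a b where a: "a \<in> comp_of c" "s \<in> tr a" and b: "b \<in> comp_of c" "s \<notin> tr b"
    using var by (auto simp: varying_def)
  obtain y where y: "\<And>u. u \<in> ?A \<Longrightarrow> y u \<in> tr u \<and> (\<forall>v\<in>comp_of c. y u \<in> tr v)"
    using attached_adj_all[OF c] by metis
  have t: "tight u" if "u \<in> ?A" for u using that by (simp add: attached_def)
  have "inj_on y ?A"
  proof (rule inj_onI)
    fix u v assume uv: "u \<in> ?A" "v \<in> ?A" "y u = y v"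
    then show "u = v" using tight_disjoint[OF t t, of u v "y u"] y[of u] y[of v] by simp
  qed
  then have "card ?A = card (y ` ?A)" by (simp add: card_image)
  also have "\<dots> \<le> card (tr a - {s})"
    using y a b finite_tr by (intro card_mono) auto
  also have "\<dots> = card (tr a) - 1" using a finite_tr by simp
  also have "\<dots> \<le> \<omega> - 2"
  proof -
    obtain u where u: "u \<in> ?A" using False by blast
    have "a \<in> U" using a c comp_subset by blast
    moreover have "a \<noteq> u" using attached_notin[OF c u] a by blast
    moreover have "a \<sim> y u" using y[OF u] a adj_sym by (auto simp: tr_def)
    ultimately have "card (tr a) \<le> \<omega> - 1" using card_tr_near_tight[OF t[OF u]] y[OF u] by blast
    then show ?thesis by simp
  qed
  finally show ?thesis .
qed simp

text \<open>
  Otherwise all vertices that touch \<open>W\<close> could leave \<open>U\<close> in exchange for one twin of each vertex of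
  \<open>W\<close>, and \<open>U\<close> would grow. The exchange keeps the set resolved because among the remaining
  vertices of \<open>U\<close> only \<open>u\<close> itself is adjacent to an element of the trace of \<open>u \<in> W\<close>.
\<close>

lemma card_le_touching:
  assumes W: "\<And>u. u \<in> W \<Longrightarrow> tight u"
  shows "card W \<le> card {r. \<exists>u\<in>W. touches r u}"
proof -
  let ?F = "{r. \<exists>u\<in>W. touches r u}"
  have "\<exists>x. x \<in> tr u \<and> (\<exists>r\<in>?F. r \<sim> u \<longleftrightarrow> \<not> r \<sim> x)" if u: "u \<in> W" for u
  proof -
    obtain r y where r: "r \<in> U" "r \<noteq> u" "y \<in> tr u" "r \<sim> y"
      using tight_has_neighbour[OF W[OF u]] by blast
    then have "r \<in> ?F" using u by (auto simp: touches_def)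
    then show ?thesis using tight_separated[OF W[OF u] r(3,4)] by blast
  qed
  then obtain x where x: "\<And>u. u \<in> W \<Longrightarrow> x u \<in> tr u"
    and sep: "\<And>u. u \<in> W \<Longrightarrow> \<exists>r\<in>?F. r \<sim> u \<longleftrightarrow> \<not> r \<sim> x u"
    by metis
  have far: "r = u" if "u \<in> W" "r \<in> U - ?F" "y \<in> tr u" "r \<sim> y" for r u y
    using that by (auto simp: touches_def)
  have "resolved ((U - ?F) \<union> x ` W) \<and> card ((U - ?F) \<union> x ` W) + card ?F = card U + card W"
  proof (rule resolved_exchange)
    show "W \<inter> ?F = {}"
    proof (rule ccontr)
      assume "W \<inter> ?F \<noteq> {}"
      then obtain r u y where r: "r \<in> W" "u \<in> W" "r \<noteq> u" "y \<in> tr u" "r \<sim> y"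
        by (auto simp: touches_def)
      then have "y \<in> tr r" using adj_sym tr_S by (auto simp: tr_def)
      then show False using tight_disjoint[OF W W] r by blast
    qed
  next
    fix a b assume ab: "a \<in> U - ?F" "b \<in> U - ?F" "a \<sim> b"
    \<comment> \<open>If only a promoted twin \<open>x u\<close> resolves the pair, then \<open>u\<close> is one of its members, and another
      element \<open>y\<close> of the trace of \<open>u\<close>, which stays in \<open>S\<close>, resolves it too.\<close>
    have "\<exists>s. s \<in> sym_diff (tr v) (tr w) \<and> s \<notin> x ` W"
      if v: "v \<in> U - ?F" and w: "w \<in> U - ?F" "v \<noteq> w" and s: "s \<in> tr v" "s \<notin> tr w" for v w s
    proof (cases "s \<in> x ` W")
      case True
      then obtain u where u: "u \<in> W" "s = x u" by blast
      have "v \<sim> s" using s(1) adj_sym by (simp add: tr_def)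
      then have vu: "v = u" using far[OF u(1) v] x[OF u(1)] u(2) by blast
      obtain y where y: "y \<in> tr u" "y \<noteq> x u" using tight_other[OF W[OF u(1)]] by blast
      have "y \<notin> tr w"
        using far[OF u(1) w(1) y(1)] w(2) vu adj_sym by (auto simp: tr_def)
      moreover have "y \<notin> x ` W"
      proof
        assume "y \<in> x ` W"
        then obtain u' where u': "u' \<in> W" "y = x u'" by blast
        then have "u = u'" using tight_disjoint[OF W[OF u(1)] W[OF u'(1)] y(1)] x by blast
        then show False using y u' by simp
      qed
      ultimately show ?thesis using y vu by blast
    qed (use s in blast)
    moreover have "a \<noteq> b" using ab adj_irrefl by blast
    moreover have "tr a \<noteq> tr b" using tr_neq ab by blast
    ultimately show "\<not> sym_diff (tr a) (tr b) \<subseteq> x ` W" using ab(1,2) by blast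
  next
    fix u v assume "u \<in> W" "v \<in> U - ?F" "v \<noteq> u" "v \<sim> x u"
    then show "\<exists>s\<in>S - x ` W. s \<sim> x u \<longleftrightarrow> \<not> s \<sim> v" using far x by blast
  qed (use W x sep in \<open>auto simp: touches_def\<close>)
  then show ?thesis using max_card[of "(U - ?F) \<union> x ` W"] by linarith
qed

text \<open>
  Besides labels and twins, the component pays one unit for every tight vertex attached to it if
  it has labels, and one unit for every vertex of \<open>F\<close> in it otherwise; a tight component receives one
  unit. Let \<open>C\<close> be the component. If tight vertices are attached to it, it has no twins. Then its cost
  without labels is \<open>card (C \<inter> F) \<le> card C\<close>, and with labels it is at most
  \<open>(card C - 1) + (\<omega> - 2)\<close>; as \<open>\<omega> \<ge> 3\<close>, both are at most \<open>(\<omega> - 2) * card C\<close>. If none are attached,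
  the cost consists of the labels and twins alone.
\<close>

lemma component_count:
  assumes c: "c \<in> U" and F: "F \<subseteq> {r. \<exists>u. tight u \<and> touches r u}"
    and poor: "varying tr (comp_of c) \<noteq> {} \<Longrightarrow> attached (comp_of c) \<noteq> {} \<Longrightarrow> comp_of c \<inter> F = {}"
  shows "card (varying tr (comp_of c)) + card (twins (comp_of c))
      + (if varying tr (comp_of c) = {} then 0 else card (attached (comp_of c)))
      + card (comp_of c \<inter> F)
    \<le> (\<omega> - 2) * card (comp_of c) + card (comp_of c \<inter> {u. tight u})"
proof -
  let ?C = "comp_of c"
  have fin: "finite ?C" using c by (rule finite_comp)
  have pos: "0 < card ?C" using fin comp_self card_gt_0_iff by blast
  have var: "card (varying tr ?C) < card ?C" using c by (rule card_varying_comp)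
  define k where "k = \<omega> - 3"
  have k: "\<omega> - 2 = k + 1" using \<omega>_ge by (simp add: k_def)
  have budget: "(\<omega> - 2) * card ?C = card ?C + k * card ?C" unfolding k by simp
  have kC: "k \<le> k * card ?C" using pos by simp
  show ?thesis
  proof (cases "attached ?C = {}")
    case False
    then have tw: "card (twins ?C) = 0" using twins_attached[OF c] by auto
    show ?thesis
    proof (cases "varying tr ?C = {}")
      case True
      have "card (?C \<inter> F) \<le> card ?C" using fin by (intro card_mono) auto
      then show ?thesis unfolding budget tw using True by simp
    next
      case v: False
      then have "?C \<inter> F = {}" using poor False by blast
      then have f: "card (?C \<inter> F) = 0" by simp
      have "card (attached ?C) \<le> k + 1" using card_attached[OF c v] k by simp
      then show ?thesis unfolding budget tw f if_not_P[OF v] using var kC by linarith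
    qed
  next
    case True
    then have att: "card (attached ?C) = 0" by simp
    have "?C \<inter> F = {}" using True F by (auto simp: attached_def)
    then have f: "card (?C \<inter> F) = 0" by simp
    show ?thesis
    proof (cases "varying tr ?C = {}")
      case False
      then have "card (twins ?C) \<le> k + 1" using card_twins_varying[OF c] k by fastforce
      then show ?thesis unfolding budget f att if_cancel using var kC by linarith
    next
      case True
      have v: "card (varying tr ?C) = 0" using True by simp
      have tw: "card (twins ?C) \<le> k + 2" using card_twins_le[OF c] k \<omega>_ge by simp
      consider "card ?C \<ge> 2" | "card (twins ?C) \<le> k + 1"
        | "card ?C = 1" "card (twins ?C) = k + 2"
        using pos tw by linarith
      then show ?thesis
      proof cases
        case 3
        have C: "?C = {c}" using 3(1) comp_self[of c] by (metis card_1_singletonE singletonD)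
        then have "tight c" using c 3(2) k \<omega>_ge by (simp add: tight_def)
        then have "card (?C \<inter> {u. tight u}) = 1" by (simp add: C)
        then show ?thesis unfolding budget f att if_cancel v using 3 kC by linarith
      next
        case 1
        then show ?thesis unfolding budget f att if_cancel v using tw kC by linarith
      next
        case 2
        then show ?thesis unfolding budget f att if_cancel v using pos kC by linarith
      qed
    qed
  qed
qed

lemma sum_card_components:
  assumes "X \<subseteq> U"
  shows "(\<Sum>C\<in>comp_of ` U. card (C \<inter> X)) = card X"
proof -
  have "X = (\<Union>C\<in>comp_of ` U. C \<inter> X)" using assms comp_self by blast
  moreover have "card (\<Union>C\<in>comp_of ` U. C \<inter> X) = (\<Sum>C\<in>comp_of ` U. card (C \<inter> X))"
  proof (rule card_UN_disjoint)
    show "\<forall>C\<in>comp_of ` U. finite (C \<inter> X)" using finite_comp by auto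
    show "\<forall>C\<in>comp_of ` U. \<forall>D\<in>comp_of ` U. C \<noteq> D \<longrightarrow> (C \<inter> X) \<inter> (D \<inter> X) = {}"
      using comp_eq by blast
  qed (use finite_U in simp)
  ultimately show ?thesis by simp
qed

text \<open>
  Let \<open>W\<close> be the set of tight vertices not attached to any component with labels. The unit received
  by a tight vertex is paid by the component with labels to which it is attached, or,
  for the vertices of \<open>W\<close>, by the vertices touching \<open>W\<close>, which are numerous enough.
\<close>

lemma card_S_le: "card S \<le> (\<omega> - 2) * card U"
proof -
  let ?K = "comp_of ` U"
  let ?att = "\<lambda>C. if varying tr C = {} then {} else attached C"
  let ?T = "{u. tight u}"
  define W where "W = ?T - (\<Union>C\<in>?K. ?att C)"
  define F where "F = {r. \<exists>u\<in>W. touches r u}"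
  have TU: "?T \<subseteq> U" using tight_U by blast
  have FU: "F \<subseteq> U" by (auto simp: F_def touches_def)
  have finK: "finite ?K" using finite_U by simp
  have "card (varying tr C) + card (twins C) + card (?att C) + card (C \<inter> F)
      \<le> (\<omega> - 2) * card C + card (C \<inter> ?T)" if C: "C \<in> ?K" for C
  proof -
    obtain c where c: "c \<in> U" "C = comp_of c" using C by blast
    have "F \<subseteq> {r. \<exists>u. tight u \<and> touches r u}" by (auto simp: F_def W_def)
    moreover have "C \<inter> F = {}" if "varying tr C \<noteq> {}"
      using that C by (fastforce simp: F_def W_def attached_def)
    ultimately show ?thesis using component_count[OF c(1), of F] unfolding c(2)[symmetric]
      by (cases "varying tr C = {}") simp_all
  qed
  then have "(\<Sum>C\<in>?K. card (varying tr C) + card (twins C) + card (?att C) + card (C \<inter> F))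
      \<le> (\<Sum>C\<in>?K. (\<omega> - 2) * card C + card (C \<inter> ?T))"
    by (rule sum_mono)
  then have main: "(\<Sum>C\<in>?K. card (varying tr C) + card (twins C)) + (\<Sum>C\<in>?K. card (?att C)) + card F
      \<le> (\<omega> - 2) * (\<Sum>C\<in>?K. card C) + card ?T"
    using sum_card_components[OF FU] sum_card_components[OF TU]
    by (simp only: sum.distrib sum_distrib_left)
  have "(\<Sum>C\<in>?K. card C) = (\<Sum>C\<in>?K. card (C \<inter> U))"
    using comp_subset by (intro sum.cong) (auto simp: Int_absorb2)
  then have sumU: "(\<Sum>C\<in>?K. card C) = card U" using sum_card_components[of U] by simp
  have "card S \<le> card (\<Union>C\<in>?K. varying tr C \<union> twins C)"
    using labelled_or_twin finite_U finite_varying_comp finite_twins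
    by (intro card_mono finite_UN_I finite_imageI) auto
  also have "\<dots> \<le> (\<Sum>C\<in>?K. card (varying tr C \<union> twins C))" using finK by (rule card_UN_le)
  also have "\<dots> \<le> (\<Sum>C\<in>?K. card (varying tr C) + card (twins C))"
    by (intro sum_mono card_Un_le)
  finally have covered: "card S \<le> (\<Sum>C\<in>?K. card (varying tr C) + card (twins C))" .
  have "card ?T \<le> card (W \<union> (\<Union>C\<in>?K. ?att C))"
    using finite_tight finK finite_attached by (intro card_mono) (auto simp: W_def)
  also have "\<dots> \<le> card W + card (\<Union>C\<in>?K. ?att C)" by (rule card_Un_le)
  also have "\<dots> \<le> card F + (\<Sum>C\<in>?K. card (?att C))"
    using card_le_touching[of W] card_UN_le[OF finK, of ?att]
    unfolding F_def by (intro add_mono) (auto simp: W_def)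
  finally show ?thesis using main covered unfolding sumU by linarith
qed

end

section \<open>The bound on the dimension\<close>

lemma (in clique_bounded_graph) ex_large_resolved:
  "\<exists>U. resolved U \<and> card V \<le> (\<omega> - 1) * card U"
proof -
  obtain U where U: "resolved U" "\<forall>U'. resolved U' \<longrightarrow> card U' \<le> card U"
    "\<forall>U'. resolved U' \<longrightarrow> card U' = card U \<longrightarrow> inner_edges (V - U') \<le> inner_edges (V - U)"
    "\<forall>U'. resolved U' \<longrightarrow> card U' = card U \<longrightarrow> inner_edges (V - U') = inner_edges (V - U)
        \<longrightarrow> sum degree U \<le> sum degree U'"
    using ex_optimal by blast
  interpret optimal_resolved V adj \<omega> U by unfold_locales (use U in blast)+
  have "card V \<le> card U + (\<omega> - 2) * card U" using card_V card_S_le by simp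
  also have "\<dots> = Suc (\<omega> - 2) * card U" by simp
  also have "Suc (\<omega> - 2) = \<omega> - 1" using \<omega>_ge by simp
  finally show ?thesis using U(1) by blast
qed

theorem theorem1p5:
  fixes G :: "('a, 'b) pre_digraph"
  assumes "graph G"
    and "Digraph_Component.connected G"
    and "card (verts G) \<ge> clique_number G + 1"
    and "clique_number G + 1 \<ge> 4"
  shows "int (local_adjacency_dim G)
    \<le> \<lfloor>((real (clique_number G) - 2) / (real (clique_number G) - 1)) * real (card (verts G))\<rfloor>"
proof -
  interpret graph G by fact
  let ?V = "verts G" and ?w = "clique_number G"
  have adj_sym: "v \<rightarrow>\<^bsub>G\<^esub> u" if "u \<rightarrow>\<^bsub>G\<^esub> v" for u v
    using arcs_ends_symmetric[OF sym_arcs that] .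
  have reach: "u \<rightarrow>\<^sup>*\<^bsub>G\<^esub> v" if "u \<in> ?V" "v \<in> ?V" for u v
    using symmetric_connected_imp_strongly_connected[OF sym_arcs assms(2)] that by blast
  interpret H: clique_bounded_graph ?V "\<lambda>u v. u \<rightarrow>\<^bsub>G\<^esub> v" ?w
  proof
    show "a \<in> ?V" if "a \<rightarrow>\<^bsub>G\<^esub> b" for a b using that by auto
    show "\<not> a \<rightarrow>\<^bsub>G\<^esub> a" for a using adj_not_same by blast
    show "\<exists>a\<in>K. \<exists>b\<in>?V - K. a \<rightarrow>\<^bsub>G\<^esub> b" if K: "K \<subseteq> ?V" "K \<noteq> {}" "K \<noteq> ?V" for K
    proof (rule ccontr)
      assume none: "\<not> ?thesis"
      obtain a b where a: "a \<in> K" and b: "b \<in> ?V - K" using K by blast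
      have "a \<rightarrow>\<^sup>*\<^bsub>G\<^esub> b" using a b K reach by blast
      then have "b \<in> K"
      proof (induction rule: reachable_induct)
        case (step x y)
        then show ?case using none adj_in_verts by blast
      qed (use a in simp)
      then show False using b by blast
    qed
    show "card K \<le> ?w" if "K \<subseteq> ?V" "\<And>a b. a \<in> K \<Longrightarrow> b \<in> K \<Longrightarrow> a \<noteq> b \<Longrightarrow> a \<rightarrow>\<^bsub>G\<^esub> b" for K
    proof -
      have "finite {K. clique G K}"
        by (rule finite_subset[of _ "Pow ?V"]) (auto simp: clique_def)
      moreover have "clique G K" using that by (simp add: clique_def)
      ultimately show ?thesis unfolding clique_number_def by (intro Max_ge) auto
    qed
  qed (use assms adj_sym in auto)
  obtain U where U: "H.resolved U" "card ?V \<le> (?w - 1) * card U"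
    using H.ex_large_resolved by blast
  have UV: "U \<subseteq> ?V" using U by (simp add: H.resolved_def)
  then have "?V - (?V - U) = U" by blast
  then have "local_adjacency_resolving G (?V - U)"
    using U(1) unfolding local_adjacency_resolving_def H.resolved_def by auto
  moreover have "finite {S. local_adjacency_resolving G S}"
    by (rule finite_subset[of _ "Pow ?V"]) (auto simp: local_adjacency_resolving_def)
  ultimately have "local_adjacency_dim G \<le> card (?V - U)"
    unfolding local_adjacency_dim_def by (intro Min_le) auto
  also have "card (?V - U) = card ?V - card U"
    using UV finite_subset[OF UV] by (simp add: card_Diff_subset)
  finally have "real (local_adjacency_dim G) \<le> real (card ?V) - real (card U)"
    using card_mono[OF _ UV] by (simp add: le_diff_conv)
  also have "\<dots> \<le> ((real ?w - 2) / (real ?w - 1)) * real (card ?V)"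
  proof -
    have "real (card ?V) \<le> real ((?w - 1) * card U)" using U(2) by linarith
    then have "real (card ?V) \<le> (real ?w - 1) * real (card U)"
      using assms(4) by (simp add: of_nat_diff)
    then show ?thesis using assms(4) by (simp add: field_simps)
  qed
  finally show ?thesis by (simp add: le_floor_iff)
qed

end
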